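(* Let $s,t\ge1$ be integers, and put $A_j^{(s,t)}=\binom{s+t-j-1}{s-j}$, $B_j^{(s,t)}=\binom{s+t-j-1}{t-j}$. Then \begin{align*} \int_0^1\frac{\mathrm{Li}_s^2(x)\mathrm{Li}_t(x)}{x}dx &=2\sum_{j=1}^sA_j^{(s,s)}\left\{\sum_{i=1}^{t-1}(-1)^{i-1}\zeta(t+1-i)\sum_{n=1}^\infty\frac{\zeta_n(j)}{n^{2s+i-j}}+(-1)^{t-1}\sum_{n=1}^\infty\frac{H_n\zeta_n(j)}{n^{2s+t-j}}\right\}\\ &\quad-2\sum_{j=1}^sA_j^{(s,s)}\,I_{2s,t}(1), \end{align*} and \begin{align*} \int_0^1\frac{\mathrm{Li}_s^2(x)\mathrm{Li}_t(x)}{x}dx &=(-1)^{s-1}\sum_{n=1}^\infty\left\{\sum_{j=1}^sA_j^{(s,t)}\frac{H_n\zeta_n(j)}{n^{2s+t-j}}+\sum_{j=1}^tB_j^{(s,t)}\frac{H_n\zeta_n(j)}{n^{2s+t-j}}\right\}\\ &\quad+\sum_{i=1}^{s-1}(-1)^{i-1}\zeta(s+1-i)\sum_{n=1}^\infty\left\{\sum_{j=1}^sA_j^{(s,t)}\frac{\zeta_n(j)}{n^{s+t+i-j}}+\sum_{j=1}^tB_j^{(s,t)}\frac{\zeta_n(j)}{n^{s+t+i-j}}\right\}\\ &\quad-\left\{\sum_{j=1}^sA_j^{(s,t)}+\sum_{j=1}^tB_j^{(s,t)}\right\}I_{s,s+t}(1). \end{align*}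
   Context: $H_n=\sum_{j=1}^n1/j$, $\zeta_n(k)=\sum_{j=1}^nj^{-k}$, $\zeta(s)=\sum_{n\ge1}n^{-s}$, $\mathrm{Li}_p(x)=\sum_{n\ge1}x^n/n^p$ (with $\mathrm{Li}_1(x)=-\ln(1-x)$), and for integers $a,b\ge1$, $I_{a,b}(1)=\int_0^1\frac{\mathrm{Li}_a(x)\mathrm{Li}_b(x)}{x}dx$. Empty sums are zero. *)

theory Defs
  imports "HOL-Analysis.Analysis"
begin

text \<open>
  All series over \<open>n \<ge> 1\<close> are written as series over \<open>n :: nat\<close> with \<open>Suc n\<close> in place of \<open>n\<close>.
  The harmonic number \<open>H\<^sub>n\<close> is the library's \<^const>\<open>harm\<close>.
\<close>

definition zeta_partial :: "nat \<Rightarrow> nat \<Rightarrow> real" where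
  "zeta_partial n k = (\<Sum>j=1..n. 1 / real j ^ k)"

text \<open>Only meaningful for \<open>k \<ge> 2\<close>; the series diverges otherwise.\<close>

definition zeta_nat :: "nat \<Rightarrow> real" where
  "zeta_nat k = (\<Sum>n. 1 / real (Suc n) ^ k)"

text \<open>
  For \<open>p \<ge> 1\<close> the series converges on \<open>[-1, 1)\<close>, and at \<open>x = 1\<close> precisely if \<open>p \<ge> 2\<close>. The value
  \<open>polylog 1 1\<close> is thus unspecified, which does not affect the integrals over \<open>[0, 1]\<close>.
  Likewise the integrands \<open>\<dots> / x\<close> have the irrelevant value \<open>0\<close> at \<open>x = 0\<close>.
\<close>

definition polylog :: "nat \<Rightarrow> real \<Rightarrow> real" where
  "polylog p x = (\<Sum>n. x ^ Suc n / real (Suc n) ^ p)"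

definition polylog_I1 :: "nat \<Rightarrow> nat \<Rightarrow> real" where
  "polylog_I1 a b = integral {0..1} (\<lambda>x. polylog a x * polylog b x / x)"

text \<open>The natural-number subtractions are exact for \<open>s, t \<ge> 1\<close> and \<open>1 \<le> j \<le> s\<close>
  (respectively \<open>1 \<le> j \<le> t\<close>).\<close>

definition coeff_A :: "nat \<Rightarrow> nat \<Rightarrow> nat \<Rightarrow> real" where
  "coeff_A s t j = real ((s + t - j - 1) choose (s - j))"

definition coeff_B :: "nat \<Rightarrow> nat \<Rightarrow> nat \<Rightarrow> real" where
  "coeff_B s t j = real ((s + t - j - 1) choose (t - j))"

end

theory Submission
  imports Defs "HOL-Real_Asymp.Real_Asymp"
begin

text \<open>
  The partial fraction decomposition of \<open>1 / (x\<^sup>s y\<^sup>t)\<close> with respect to \<open>x + y\<close>, inserted into the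
  Cauchy product of the two series, gives \<open>Li\<^sub>s Li\<^sub>t\<close> as a power series whose nonnegative coefficients are
  combinations of \<open>\<zeta>\<^sub>n(j) / n\<^bsup>s+t-j\<^esup>\<close>, minus a multiple of \<open>Li\<^bsub>s+t\<^esub>\<close>. By monotone convergence
  it may be integrated against \<open>Li\<^sub>p(x) / x\<close> term by term, using
  \<open>\<integral> x\<^bsup>n-1\<^esup> Li\<^sub>p(x) dx = \<Sum>\<^sub>k 1 / (k\<^sup>p (k + n))\<close>, and this kernel reduces to zeta values and \<open>H\<^sub>n\<close>
  by lowering \<open>p\<close>. Grouping the triple product as \<open>(Li\<^sub>s Li\<^sub>s) Li\<^sub>t\<close> or as \<open>(Li\<^sub>s Li\<^sub>t) Li\<^sub>s\<close> yields the two
  formulas. All convergence questions come down to \<open>\<Sum>\<^sub>n (H\<^sub>n / n)\<^sup>2 < \<infinity>\<close>.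
\<close>

section \<open>Partial fractions for a product of two inverse powers\<close>

lemma coeff_B_eq_coeff_A: "coeff_B s t j = coeff_A t s j"
  by (simp add: coeff_A_def coeff_B_def add.commute)

lemma coeff_A_nonneg: "coeff_A s t j \<ge> 0"
  by (simp add: coeff_A_def)

lemma coeff_A_Pascal:
  assumes "j \<le> s"
  shows "coeff_A (Suc s) (Suc t) j = coeff_A s (Suc t) j + coeff_A (Suc s) t j"
proof -
  have "Suc s + Suc t - j - 1 = Suc (s + t - j)" "Suc s - j = Suc (s - j)"
    "s + Suc t - j - 1 = s + t - j" "Suc s + t - j - 1 = s + t - j"
    using assms by auto
  then show ?thesis
    by (simp add: coeff_A_def)
qed

lemma coeff_A_diag: "coeff_A s t s = 1"
  by (simp add: coeff_A_def)

text \<open>The half of the decomposition that contains the powers of \<open>x\<close>, with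
  \<open>z\<close> standing for x + y. The half with the powers of y arises by exchanging
  \<open>s\<close> and \<open>t\<close>.\<close>

definition partial_fraction_sum :: "nat \<Rightarrow> nat \<Rightarrow> real \<Rightarrow> real \<Rightarrow> real" where
  "partial_fraction_sum s t x z = (\<Sum>j=1..s. coeff_A s t j / (x ^ j * z ^ (s + t - j)))"

text \<open>Pascal's rule for each \<open>j \<le> s\<close>. The index \<open>j = Suc s\<close>
  occurs on the right only in \<open>partial_fraction_sum (Suc s) t x z\<close>, with coefficient 1
  on both sides.\<close>

lemma partial_fraction_sum_rec:
  assumes "z \<noteq> 0"
  shows "partial_fraction_sum (Suc s) (Suc t) x z =
    (partial_fraction_sum s (Suc t) x z + partial_fraction_sum (Suc s) t x z) / z"
proof -
  have "partial_fraction_sum (Suc s) (Suc t) x z =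
      (\<Sum>j=1..s. coeff_A (Suc s) (Suc t) j / (x ^ j * z ^ (Suc s + Suc t - j))) +
      1 / (x ^ Suc s * z ^ Suc t)"
    by (simp add: partial_fraction_sum_def coeff_A_diag)
  also have "(\<Sum>j=1..s. coeff_A (Suc s) (Suc t) j / (x ^ j * z ^ (Suc s + Suc t - j))) =
     (\<Sum>j=1..s. coeff_A s (Suc t) j / (x ^ j * z ^ (s + Suc t - j)) / z +
       coeff_A (Suc s) t j / (x ^ j * z ^ (Suc s + t - j)) / z)"
  proof (rule sum.cong[OF refl])
    fix j assume "j \<in> {1..s}"
    then have j: "j \<le> s" by simp
    have "Suc s + Suc t - j = Suc (Suc s + t - j)" "s + Suc t - j = Suc s + t - j"
      using j by auto
    then show "coeff_A (Suc s) (Suc t) j / (x ^ j * z ^ (Suc s + Suc t - j)) =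
       coeff_A s (Suc t) j / (x ^ j * z ^ (s + Suc t - j)) / z +
       coeff_A (Suc s) t j / (x ^ j * z ^ (Suc s + t - j)) / z"
      by (simp add: coeff_A_Pascal[OF j] add_divide_distrib mult_ac)
  qed
  finally show ?thesis
    by (simp add: partial_fraction_sum_def coeff_A_diag sum.distrib sum_divide_distrib
        add_divide_distrib mult_ac)
qed

lemma partial_fraction_sum_0_left: "partial_fraction_sum 0 t x z = 0"
  by (simp add: partial_fraction_sum_def)

text \<open>Truncated subtraction makes \<^const>\<open>coeff_A\<close> the indicator of \<open>j = s\<close> when \<open>t = 0\<close>.\<close>

lemma partial_fraction_sum_0_right: "partial_fraction_sum s 0 x z = (if s = 0 then 0 else 1 / x ^ s)"
proof -
  have "coeff_A s 0 j = 0" if "j < s" for j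
    using that by (simp add: coeff_A_def)
  then have "partial_fraction_sum s 0 x z = (\<Sum>j=1..s. if j = s then 1 / x ^ s else 0)"
    unfolding partial_fraction_sum_def by (intro sum.cong refl) (auto simp: coeff_A_diag)
  then show ?thesis by (cases "s = 0") auto
qed

text \<open>For positive exponents both sides satisfy F(s,t) = (F(s-1,t) + F(s,t-1)) / (x + y),
  which gives an induction on s + t. If one exponent is 0, one half vanishes and the other is the
  remaining inverse power.\<close>

lemma partial_fractions:
  fixes x y :: real
  assumes "x \<noteq> 0" "y \<noteq> 0" "x + y \<noteq> 0" "s + t \<ge> 1"
  shows "1 / (x ^ s * y ^ t) = partial_fraction_sum s t x (x + y) + partial_fraction_sum t s y (x + y)"
  using assms(4)
proof (induction "s + t" arbitrary: s t)
  case 0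
  then show ?case by simp
next
  case (Suc n)
  show ?case
  proof (cases s)
    case 0
    then show ?thesis using Suc.prems
      by (simp add: partial_fraction_sum_0_left partial_fraction_sum_0_right)
  next
    case s: (Suc s')
    show ?thesis
    proof (cases t)
      case 0
      then show ?thesis using s
        by (simp add: partial_fraction_sum_0_left partial_fraction_sum_0_right)
    next
      case t: (Suc t')
      have "1 / (x ^ s * y ^ t) = (1 / (x ^ s' * y ^ t) + 1 / (x ^ s * y ^ t')) / (x + y)"
        unfolding s t using assms(1-3) by (simp add: divide_simps)
      also have "1 / (x ^ s' * y ^ t) =
          partial_fraction_sum s' t x (x + y) + partial_fraction_sum t s' y (x + y)"
        by (rule Suc.hyps) (use Suc.hyps(2) s t in auto)
      also have "1 / (x ^ s * y ^ t') =
          partial_fraction_sum s t' x (x + y) + partial_fraction_sum t' s y (x + y)"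
        by (rule Suc.hyps) (use Suc.hyps(2) s t in auto)
      finally show ?thesis
        unfolding s t partial_fraction_sum_rec[OF assms(3)] by (simp add: add_divide_distrib)
    qed
  qed
qed

section \<open>Power series of a product of two polylogarithms\<close>

definition harm_weight :: "nat \<Rightarrow> nat \<Rightarrow> nat \<Rightarrow> real" where
  "harm_weight s t n = (\<Sum>j=1..s. coeff_A s t j * (zeta_partial (Suc n) j / real (Suc n) ^ (s + t - j)))"

text \<open>The coefficient of \<open>x ^ Suc n\<close> in Li_s Li_t: the positive indices
  \<open>Suc i\<close> and \<open>n - i\<close> add up to \<open>Suc n\<close>.\<close>

definition polylog_prod_coeff :: "nat \<Rightarrow> nat \<Rightarrow> nat \<Rightarrow> real" where
  "polylog_prod_coeff s t n = (\<Sum>i<n. 1 / (real (Suc i) ^ s * real (n - i) ^ t))"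

lemma zeta_partial_Suc: "zeta_partial (Suc n) k = zeta_partial n k + 1 / real (Suc n) ^ k"
  by (simp add: zeta_partial_def)

lemma zeta_partial_altdef: "zeta_partial n k = (\<Sum>i<n. 1 / real (Suc i) ^ k)"
  by (induction n) (simp_all add: zeta_partial_Suc, simp add: zeta_partial_def)

lemma zeta_partial_nonneg: "zeta_partial n k \<ge> 0"
  by (simp add: zeta_partial_def sum_nonneg)

lemma zeta_partial_le_harm:
  assumes "k \<ge> 1"
  shows "zeta_partial n k \<le> harm n"
  unfolding zeta_partial_def harm_def
proof (rule sum_mono)
  fix j assume "j \<in> {1..n}"
  then have j: "real j \<ge> 1" by simp
  with assms have "real j ^ 1 \<le> real j ^ k"
    by (intro power_increasing) auto
  moreover have "real j > 0" using j by linarith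
  ultimately
  show "1 / real j ^ k \<le> inverse (real j)"
    by (simp add: divide_simps)
qed

text \<open>The sum over \<open>i < n\<close> produces zeta_n(j), whereas \<open>harm_weight\<close>
  contains zeta_{n+1}(j). The missing term 1/(n+1)^j turns the j-th denominator into (n+1)^(s+t) for
  every j, so the corrections collect into one multiple of that power.\<close>

lemma sum_partial_fraction_sum:
  "(\<Sum>i<n. partial_fraction_sum s t (real (Suc i)) (real (Suc n))) =
    harm_weight s t n - (\<Sum>j=1..s. coeff_A s t j) / real (Suc n) ^ (s + t)"
proof -
  have "(\<Sum>i<n. partial_fraction_sum s t (real (Suc i)) (real (Suc n))) =
      (\<Sum>j=1..s. \<Sum>i<n. coeff_A s t j / (real (Suc i) ^ j * real (Suc n) ^ (s + t - j)))"
    unfolding partial_fraction_sum_def by (rule sum.swap)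
  also have "\<dots> = (\<Sum>j=1..s. coeff_A s t j * (zeta_partial (Suc n) j / real (Suc n) ^ (s + t - j)) -
      coeff_A s t j / real (Suc n) ^ (s + t))"
  proof (rule sum.cong[OF refl])
    fix j assume "j \<in> {1..s}"
    then have "s + t = j + (s + t - j)" by auto
    then have pw: "real (Suc n) ^ (s + t) = real (Suc n) ^ j * real (Suc n) ^ (s + t - j)"
      by (metis power_add)
    have "(\<Sum>i<n. coeff_A s t j / (real (Suc i) ^ j * real (Suc n) ^ (s + t - j))) =
        coeff_A s t j / real (Suc n) ^ (s + t - j) * zeta_partial n j"
      unfolding zeta_partial_altdef sum_distrib_left by (intro sum.cong refl) (simp add: field_simps)
    also have "zeta_partial n j = zeta_partial (Suc n) j - 1 / real (Suc n) ^ j"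
      by (simp add: zeta_partial_Suc)
    finally show "(\<Sum>i<n. coeff_A s t j / (real (Suc i) ^ j * real (Suc n) ^ (s + t - j))) =
      coeff_A s t j * (zeta_partial (Suc n) j / real (Suc n) ^ (s + t - j)) -
      coeff_A s t j / real (Suc n) ^ (s + t)"
      unfolding pw by (simp add: right_diff_distrib diff_divide_distrib mult_ac)
  qed
  finally show ?thesis
    by (simp add: harm_weight_def sum_subtractf sum_divide_distrib)
qed

text \<open>Partial fractions with x = i + 1 and y = n - i, where x + y = n + 1 is the same for all
  i. Reflecting i to n - 1 - i brings the second half into the form of the first.\<close>

lemma polylog_prod_coeff_eq:
  assumes "s \<ge> 1"
  shows "polylog_prod_coeff s t n = harm_weight s t n + harm_weight t s n -
    ((\<Sum>j=1..s. coeff_A s t j) + (\<Sum>j=1..t. coeff_A t s j)) / real (Suc n) ^ (s + t)"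
proof -
  have "polylog_prod_coeff s t n = (\<Sum>i<n. partial_fraction_sum s t (real (Suc i)) (real (Suc n)) +
      partial_fraction_sum t s (real (Suc (n - Suc i))) (real (Suc n)))"
    unfolding polylog_prod_coeff_def
  proof (rule sum.cong[OF refl])
    fix i assume i: "i \<in> {..<n}"
    then have *: "n - i = Suc (n - Suc i)" by auto
    have **: "real (Suc i) + real (Suc (n - Suc i)) = real (Suc n)"
      using i by (simp add: of_nat_diff)
    show "1 / (real (Suc i) ^ s * real (n - i) ^ t) =
      partial_fraction_sum s t (real (Suc i)) (real (Suc n)) +
      partial_fraction_sum t s (real (Suc (n - Suc i))) (real (Suc n))"
      unfolding * using partial_fractions[of "real (Suc i)" "real (Suc (n - Suc i))" s t] assms
      unfolding ** by simp
  qed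
  also have "\<dots> = (\<Sum>i<n. partial_fraction_sum s t (real (Suc i)) (real (Suc n))) +
      (\<Sum>i<n. partial_fraction_sum t s (real (Suc i)) (real (Suc n)))"
    by (simp only: sum.distrib
        sum.nat_diff_reindex[of "\<lambda>i. partial_fraction_sum t s (real (Suc i)) (real (Suc n))"])
  finally show ?thesis
    by (simp add: sum_partial_fraction_sum add.commute add_divide_distrib del: of_nat_Suc)
qed

lemma polylog_prod_coeff_nonneg: "polylog_prod_coeff s t n \<ge> 0"
  by (auto simp: polylog_prod_coeff_def intro!: sum_nonneg)

lemma summable_norm_polylog:
  assumes "\<bar>x\<bar> < 1"
  shows "summable (\<lambda>n. norm (x ^ Suc n / real (Suc n) ^ p))"
proof (rule summable_comparison_test)
  show "summable (\<lambda>n. \<bar>x\<bar> ^ n)" using assms by (simp add: summable_geometric)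
  have "norm (norm (x ^ Suc n / real (Suc n) ^ p)) \<le> \<bar>x\<bar> ^ n" for n
  proof -
    have "1 \<le> real (Suc n) ^ p" by (rule one_le_power) simp
    moreover have "\<bar>x\<bar> ^ Suc n \<le> \<bar>x\<bar> ^ n"
      using assms by (intro power_decreasing) auto
    ultimately have "\<bar>x\<bar> ^ Suc n / real (Suc n) ^ p \<le> \<bar>x\<bar> ^ n / 1"
      by (intro frac_le) auto
    then show ?thesis by (simp add: power_abs abs_mult)
  qed
  then show "\<exists>N. \<forall>n\<ge>N. norm (norm (x ^ Suc n / real (Suc n) ^ p)) \<le> \<bar>x\<bar> ^ n" by blast
qed

lemma polylog_sums:
  assumes "\<bar>x\<bar> < 1"
  shows "(\<lambda>n. x ^ Suc n / real (Suc n) ^ p) sums polylog p x"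
  unfolding polylog_def
  using summable_norm_cancel[OF summable_norm_polylog[OF assms]] by (rule summable_sums)

lemma polylog_0 [simp]: "polylog p 0 = 0"
  by (simp add: polylog_def)

lemma polylog_prod_sums:
  assumes "\<bar>x\<bar> < 1"
  shows "(\<lambda>n. polylog_prod_coeff s t n * x ^ Suc n) sums (polylog s x * polylog t x)"
proof -
  have "(\<lambda>k. \<Sum>i\<le>k. x ^ Suc i / real (Suc i) ^ s * (x ^ Suc (k - i) / real (Suc (k - i)) ^ t)) sums
      (polylog s x * polylog t x)"
    using Cauchy_product_sums[OF summable_norm_polylog[OF assms, of s] summable_norm_polylog[OF assms, of t]]
    by (simp add: polylog_def)
  also have "(\<lambda>k. \<Sum>i\<le>k. x ^ Suc i / real (Suc i) ^ s * (x ^ Suc (k - i) / real (Suc (k - i)) ^ t)) =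
      (\<lambda>k. polylog_prod_coeff s t (Suc k) * x ^ Suc (Suc k))"
  proof
    fix k
    have "x ^ Suc i / real (Suc i) ^ s * (x ^ Suc (k - i) / real (Suc (k - i)) ^ t) =
        1 / (real (Suc i) ^ s * real (Suc k - i) ^ t) * x ^ Suc (Suc k)" if "i \<le> k" for i
    proof -
      have "x ^ Suc i * x ^ Suc (k - i) = x ^ Suc (Suc k)"
        using that by (simp flip: power_add)
      moreover have "Suc k - i = Suc (k - i)" using that by auto
      ultimately show ?thesis by (metis times_divide_times_eq mult_1 times_divide_eq_left)
    qed
    then show "(\<Sum>i\<le>k. x ^ Suc i / real (Suc i) ^ s * (x ^ Suc (k - i) / real (Suc (k - i)) ^ t)) =
      polylog_prod_coeff s t (Suc k) * x ^ Suc (Suc k)"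
      unfolding polylog_prod_coeff_def sum_distrib_right lessThan_Suc_atMost
      by (intro sum.cong refl) auto
  qed
  \<comment> \<open>The Cauchy product starts at x^2, so its index is off by one; the term put in
    front is 0 because \<open>polylog_prod_coeff s t 0\<close> is an empty sum.\<close>
  finally show ?thesis
    by (subst (asm) sums_Suc_iff) (simp add: polylog_prod_coeff_def)
qed

section \<open>The kernel and its reduction to zeta values\<close>

definition shifted_zeta :: "nat \<Rightarrow> nat \<Rightarrow> real" where
  "shifted_zeta p m = (\<Sum>k. 1 / (real (Suc k) ^ p * real (Suc k + m)))"

text \<open>Since 1/(k(k+m)) = (1/k - 1/(k+m)) / m, it suffices that the differences sum to H_m,
  which goes by induction on \<open>m\<close>.\<close>

lemma shifted_zeta_1_sums:
  assumes "m \<ge> 1"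
  shows "(\<lambda>k. 1 / (real (Suc k) ^ 1 * real (Suc k + m))) sums (harm m / real m)"
proof -
  have "(\<lambda>k. 1 / real (Suc k) - 1 / real (Suc k + m)) sums harm m"
  proof (induction m)
    case 0
    then show ?case by (simp add: harm_def)
  next
    case (Suc m)
    \<comment> \<open>Passing from m to m + 1 adds the differences 1/(k+m) - 1/(k+m+1) for k from 1
      on, which telescope to 1/(m+1).\<close>
    have "(\<lambda>k. 1 / real (Suc k + m)) \<longlonglongrightarrow> 0"
      by real_asymp
    from sums_add[OF Suc telescope_sums'[OF this]]
    have "(\<lambda>k. 1 / real (Suc k) - 1 / real (Suc k + m) +
        (1 / real (Suc k + m) - 1 / real (Suc (Suc k) + m))) sums harm (Suc m)"
      by (simp add: harm_Suc inverse_eq_divide)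
    then show ?case by simp
  qed
  from sums_divide[OF this, of "real m"]
  have "(\<lambda>k. (1 / real (Suc k) - 1 / real (Suc k + m)) / real m) sums (harm m / real m)" .
  also have "(\<lambda>k. (1 / real (Suc k) - 1 / real (Suc k + m)) / real m) =
      (\<lambda>k. 1 / (real (Suc k) ^ 1 * real (Suc k + m)))"
  proof
    fix k
    have diff: "real (Suc k + m) - real (Suc k) = real m" by simp
    show "(1 / real (Suc k) - 1 / real (Suc k + m)) / real m = 1 / (real (Suc k) ^ 1 * real (Suc k + m))"
      using assms by (simp add: diff_frac_eq diff del: of_nat_Suc of_nat_add add_Suc)
  qed
  finally show ?thesis .
qed

lemma summable_zeta_nat: "p \<ge> 2 \<Longrightarrow> summable (\<lambda>k. 1 / real (Suc k) ^ p)"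
  using inverse_power_summable[of p, where ?'a = real] summable_Suc_iff[of "\<lambda>k. inverse (real k ^ p)"]
  by (simp add: inverse_eq_divide)

lemma summable_shifted_zeta:
  assumes "p \<ge> 1" "m \<ge> 1"
  shows "summable (\<lambda>k. 1 / (real (Suc k) ^ p * real (Suc k + m)))"
proof (rule summable_comparison_test)
  show "summable (\<lambda>k. 1 / (real (Suc k) ^ 1 * real (Suc k + m)))"
    using shifted_zeta_1_sums[OF assms(2)] by (rule sums_summable)
  have "norm (1 / (real (Suc k) ^ p * real (Suc k + m))) \<le> 1 / (real (Suc k) ^ 1 * real (Suc k + m))" for k
  proof -
    have "real (Suc k) ^ 1 \<le> real (Suc k) ^ p"
      using assms by (intro power_increasing) auto
    then have "1 / (real (Suc k) ^ p * real (Suc k + m)) \<le> 1 / (real (Suc k) ^ 1 * real (Suc k + m))"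
      by (intro divide_left_mono mult_right_mono) auto
    then show ?thesis by simp
  qed
  then show "\<exists>N. \<forall>k\<ge>N. norm (1 / (real (Suc k) ^ p * real (Suc k + m))) \<le>
      1 / (real (Suc k) ^ 1 * real (Suc k + m))" by blast
qed

lemma shifted_zeta_1: "m \<ge> 1 \<Longrightarrow> shifted_zeta 1 m = harm m / real m"
  unfolding shifted_zeta_def using shifted_zeta_1_sums by (rule sums_unique[symmetric])

text \<open>Termwise, 1/(k^(p+1) (k+m)) = (1/k^(p+1) - 1/(k^p (k+m))) / m, and both series on the
  right converge for \<open>p \<ge> 1\<close>.\<close>

lemma shifted_zeta_Suc:
  assumes "p \<ge> 1" "m \<ge> 1"
  shows "shifted_zeta (Suc p) m = (zeta_nat (Suc p) - shifted_zeta p m) / real m"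
proof -
  have "(\<lambda>k. (1 / real (Suc k) ^ Suc p - 1 / (real (Suc k) ^ p * real (Suc k + m))) / real m) sums
      ((zeta_nat (Suc p) - shifted_zeta p m) / real m)"
    unfolding zeta_nat_def shifted_zeta_def
    by (intro sums_divide sums_diff summable_sums summable_zeta_nat summable_shifted_zeta assms)
       (use assms in auto)
  also have "(\<lambda>k. (1 / real (Suc k) ^ Suc p - 1 / (real (Suc k) ^ p * real (Suc k + m))) / real m) =
      (\<lambda>k. 1 / (real (Suc k) ^ Suc p * real (Suc k + m)))"
  proof
    fix k
    show "(1 / real (Suc k) ^ Suc p - 1 / (real (Suc k) ^ p * real (Suc k + m))) / real m =
        1 / (real (Suc k) ^ Suc p * real (Suc k + m))"
      using assms by (simp add: divide_simps)
  qed
  finally show ?thesis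
    unfolding shifted_zeta_def by (rule sums_unique[symmetric])
qed

text \<open>The recursion \<open>shifted_zeta_Suc\<close> unrolled down to p = 1: each pass
  contributes a zeta value, divides by m and flips the sign, and H_m/m remains at the end.\<close>

lemma shifted_zeta_eq:
  assumes "p \<ge> 1" "m \<ge> 1"
  shows "shifted_zeta p m = (\<Sum>i=1..p-1. (-1) ^ (i-1) * zeta_nat (p + 1 - i) / real m ^ i) +
    (-1) ^ (p - 1) * harm m / real m ^ p"
  using assms(1)
proof (induction p rule: dec_induct)
  case base
  then show ?case using shifted_zeta_1[OF assms(2)] by simp
next
  case (step p)
  \<comment> \<open>The summand \<open>i = 1\<close> is the new zeta value; the others are the old
    sum with its index shifted by one.\<close>
  have "(\<Sum>i=1..Suc p-1. (-1) ^ (i-1) * zeta_nat (Suc p + 1 - i) / real m ^ i) =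
     zeta_nat (Suc p) / real m + (\<Sum>i=Suc 1..p. (-1) ^ (i-1) * zeta_nat (Suc p + 1 - i) / real m ^ i)"
    using step by (simp add: sum.atLeast_Suc_atMost)
  also have "(\<Sum>i=Suc 1..p. (-1) ^ (i-1) * zeta_nat (Suc p + 1 - i) / real m ^ i) =
     (\<Sum>i=1..p-1. (-1) ^ i * zeta_nat (p + 1 - i) / real m ^ Suc i)"
    using step sum.shift_bounds_cl_Suc_ivl[of "\<lambda>i. (-1) ^ (i-1) * zeta_nat (Suc p + 1 - i) / real m ^ i" 1 "p - 1"]
    by simp
  also have "\<dots> = - (\<Sum>i=1..p-1. (-1) ^ (i-1) * zeta_nat (p + 1 - i) / real m ^ i) / real m"
    unfolding sum_negf[symmetric] sum_divide_distrib
  proof (rule sum.cong[OF refl])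
    fix i assume "i \<in> {1..p-1}"
    then obtain i' where "i = Suc i'" by (cases i) auto
    then show "(-1) ^ i * zeta_nat (p + 1 - i) / real m ^ Suc i =
        - ((-1) ^ (i-1) * zeta_nat (p + 1 - i) / real m ^ i) / real m"
      by simp
  qed
  finally have *: "(\<Sum>i=1..Suc p-1. (-1) ^ (i-1) * zeta_nat (Suc p + 1 - i) / real m ^ i) =
    zeta_nat (Suc p) / real m - (\<Sum>i=1..p-1. (-1) ^ (i-1) * zeta_nat (p + 1 - i) / real m ^ i) / real m"
    by simp
  have sgn: "(-1::real) ^ (Suc p - 1) = - ((-1) ^ (p - 1))"
    using step by (cases p) auto
  show ?case
    unfolding * sgn shifted_zeta_Suc[OF step.hyps(1) assms(2)] step.IH
    by (simp add: add_divide_distrib diff_divide_distrib)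
qed

lemma shifted_zeta_nonneg: "p \<ge> 1 \<Longrightarrow> m \<ge> 1 \<Longrightarrow> shifted_zeta p m \<ge> 0"
  unfolding shifted_zeta_def by (intro suminf_nonneg summable_shifted_zeta) auto

text \<open>Comparison with p = 1. With \<open>shifted_zeta_nonneg\<close>, this makes the kernel
  fit the convergence criterion \<open>summable_mult_harm_bounded\<close>.\<close>

lemma shifted_zeta_le:
  assumes "p \<ge> 1" "m \<ge> 1"
  shows "shifted_zeta p m \<le> harm m / real m"
  unfolding shifted_zeta_1[OF assms(2), symmetric] shifted_zeta_def
proof (intro suminf_le summable_shifted_zeta assms order.refl)
  fix k
  have "real (Suc k) ^ 1 \<le> real (Suc k) ^ p"
    using assms by (intro power_increasing) auto
  then show "1 / (real (Suc k) ^ p * real (Suc k + m)) \<le> 1 / (real (Suc k) ^ 1 * real (Suc k + m))"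
    by (intro divide_left_mono mult_right_mono) auto
qed

section \<open>Term-by-term integration\<close>

text \<open>Monotone convergence for the partial sums: they increase because the terms are
  nonnegative, and summability of \<open>c\<close> supplies the limit of their integrals.\<close>

lemma has_integral_suminf_nonneg:
  fixes f :: "nat \<Rightarrow> 'a::euclidean_space \<Rightarrow> real"
  assumes "\<And>n. (f n has_integral c n) S"
    and "\<And>n x. x \<in> S \<Longrightarrow> f n x \<ge> 0"
    and "\<And>x. x \<in> S \<Longrightarrow> (\<lambda>n. f n x) sums g x"
    and "summable c"
  shows "(g has_integral suminf c) S"
proof (rule has_integral_monotone_convergence_increasing)
  show "((\<lambda>x. \<Sum>i<k. f i x) has_integral (\<Sum>i<k. c i)) S" for k
    by (intro has_integral_sum assms) auto
  show "(\<lambda>k. \<Sum>i<k. f i x) \<longlonglongrightarrow> g x" if "x \<in> S" for x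
    using assms(3)[OF that] by (simp add: sums_def)
  show "(\<lambda>k. \<Sum>i<k. c i) \<longlonglongrightarrow> suminf c"
    using assms(4) by (rule summable_LIMSEQ)
qed (use assms(2) in auto)

text \<open>Allows the endpoint 1, where the power series may diverge, to be dropped as a negligible
  set.\<close>

lemma has_integral_Icc_iff_Ico:
  fixes f :: "real \<Rightarrow> 'a :: banach"
  shows "(f has_integral I) {a..b} \<longleftrightarrow> (f has_integral I) {a..<b}"
  by (rule has_integral_spike_set_eq; rule negligible_subset[of "{b}"]) auto

lemma power_mult_polylog_has_integral:
  assumes "p \<ge> 1"
  shows "((\<lambda>x. x ^ n * polylog p x) has_integral shifted_zeta p (Suc n)) {0..1}"
  unfolding has_integral_Icc_iff_Ico shifted_zeta_def
proof (rule has_integral_suminf_nonneg)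
  fix k
  have "((\<lambda>x::real. x ^ (n + Suc k)) has_integral 1 / real (Suc k + Suc n)) {0..1}"
  proof -
    have "((\<lambda>x::real. x ^ (n + Suc k)) has_integral
        1 ^ Suc (n + Suc k) / real (Suc (n + Suc k)) - 0 ^ Suc (n + Suc k) / real (Suc (n + Suc k))) {0..1}"
      by (intro fundamental_theorem_of_calculus)
         (auto simp del: power_Suc of_nat_Suc simp flip: has_real_derivative_iff_has_vector_derivative
           intro!: derivative_eq_intros)
    then show ?thesis by (simp add: add_ac)
  qed
  from has_integral_divide[OF this, of "real (Suc k) ^ p"]
  show "((\<lambda>x. x ^ n * (x ^ Suc k / real (Suc k) ^ p)) has_integral
      1 / (real (Suc k) ^ p * real (Suc k + Suc n))) {0..<1}"
    unfolding has_integral_Icc_iff_Ico by (simp add: power_add mult_ac)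
next
  show "(\<lambda>k. x ^ n * (x ^ Suc k / real (Suc k) ^ p)) sums (x ^ n * polylog p x)"
    if "x \<in> {0..<1}" for x
    using that by (intro sums_mult polylog_sums) auto
next
  show "summable (\<lambda>k. 1 / (real (Suc k) ^ p * real (Suc k + Suc n)))"
    using assms by (intro summable_shifted_zeta) auto
qed auto

section \<open>Summability from harmonic bounds\<close>

text \<open>From H_n \<le> 1 + ln n; the exponent -3/2 leaves room between -2 and -1 to absorb the
  squared logarithm.\<close>

lemma summable_harm_sq: "summable (\<lambda>n. (harm (Suc n) / real (Suc n))\<^sup>2 :: real)"
proof (rule summable_comparison_test)
  have "summable (\<lambda>n. norm (real (Suc n) powr (-3/2)))"
    using summable_Suc_iff[of "\<lambda>n. real n powr (-3/2)"] by (simp add: summable_real_powr_iff)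
  moreover have "(\<lambda>n. ((1 + ln (real (Suc n))) / real (Suc n))\<^sup>2) \<in> O(\<lambda>n. real (Suc n) powr (-3/2))"
    by real_asymp
  ultimately show "summable (\<lambda>n. ((1 + ln (real (Suc n))) / real (Suc n))\<^sup>2)"
    by (rule summable_comparison_test_bigo)
  have "(harm (Suc n) / real (Suc n))\<^sup>2 \<le> ((1 + ln (real (Suc n))) / real (Suc n))\<^sup>2" for n
  proof (intro power_mono divide_right_mono divide_nonneg_nonneg harm_nonneg)
    \<comment> \<open>The difference H_n - ln n is decreasing and equals 1 at n = 1.\<close>
    have "harm (Suc n) - ln (real (Suc n)) \<le> harm (Suc 0) - ln (real (Suc 0))"
      using decseqD[OF decseq_harm_diff_ln, of 0 n] by (simp del: of_nat_Suc)
    moreover have "harm (Suc 0) = (1 :: real)" by (simp add: harm_def)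
    ultimately show "harm (Suc n) \<le> 1 + ln (real (Suc n))" by simp
  qed simp_all
  then show "\<exists>N. \<forall>n\<ge>N. norm ((harm (Suc n) / real (Suc n))\<^sup>2 :: real) \<le>
      ((1 + ln (real (Suc n))) / real (Suc n))\<^sup>2" by (simp del: of_nat_Suc)
qed

text \<open>The common convergence criterion: \<open>a\<close> will be a coefficient sequence, with
  \<open>C\<close> a sum of binomial coefficients or 1, and \<open>b\<close> the kernel or one of
  the pieces of its closed form.\<close>

lemma summable_mult_harm_bounded:
  assumes "\<And>n. 0 \<le> a n" "\<And>n. a n \<le> C * (harm (Suc n) / real (Suc n))"
    and "\<And>n. 0 \<le> b n" "\<And>n. b n \<le> harm (Suc n) / real (Suc n)"
  shows "summable (\<lambda>n. a n * b n :: real)"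
proof (rule summable_comparison_test)
  show "summable (\<lambda>n. C * (harm (Suc n) / real (Suc n))\<^sup>2)"
    by (intro summable_mult summable_harm_sq)
  have "a n * b n \<le> C * (harm (Suc n) / real (Suc n))\<^sup>2" for n
  proof -
    have "0 \<le> C * (harm (Suc n) / real (Suc n))"
      using assms(1,2) order_trans by blast
    then have "a n * b n \<le> (C * (harm (Suc n) / real (Suc n))) * (harm (Suc n) / real (Suc n))"
      by (intro mult_mono assms)
    then show ?thesis by (simp add: power2_eq_square mult_ac)
  qed
  then show "\<exists>N. \<forall>n\<ge>N. norm (a n * b n) \<le> C * (harm (Suc n) / real (Suc n))\<^sup>2"
    using assms(1,3) by simp
qed

lemma one_le_harm_Suc: "1 \<le> (harm (Suc n) :: real)"
  using harm_mono[of 1 "Suc n", where ?'a = real] by (simp add: harm_def)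

lemma harm_div_power_le: "p \<ge> 1 \<Longrightarrow> harm (Suc n) / real (Suc n) ^ p \<le> harm (Suc n) / real (Suc n)"
  using power_increasing[of 1 p "real (Suc n)"]
  by (intro divide_left_mono) (auto simp: harm_nonneg)

lemma inverse_power_le_harm:
  assumes "p \<ge> 1"
  shows "1 / real (Suc n) ^ p \<le> harm (Suc n) / real (Suc n)"
proof -
  have "1 / real (Suc n) ^ p \<le> harm (Suc n) / real (Suc n) ^ p"
    by (intro divide_right_mono one_le_harm_Suc) auto
  also note harm_div_power_le[OF assms]
  finally show ?thesis .
qed

lemma zeta_partial_div_power_le_harm:
  assumes "j \<ge> 1" "p \<ge> 1"
  shows "zeta_partial (Suc n) j / real (Suc n) ^ p \<le> harm (Suc n) / real (Suc n)"
proof -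
  have "zeta_partial (Suc n) j / real (Suc n) ^ p \<le> harm (Suc n) / real (Suc n) ^ p"
    by (intro divide_right_mono zeta_partial_le_harm assms) auto
  also note harm_div_power_le[OF assms(2)]
  finally show ?thesis .
qed

lemma harm_weight_nonneg: "harm_weight s t n \<ge> 0"
  unfolding harm_weight_def
  by (intro sum_nonneg mult_nonneg_nonneg divide_nonneg_nonneg coeff_A_nonneg zeta_partial_nonneg) auto

text \<open>For \<open>j \<le> s\<close>, the assumption \<open>t \<ge> 1\<close> leaves at least
  one power of \<open>Suc n\<close> in the denominator, and each zeta_n(j) is at most H_n.\<close>

lemma harm_weight_le:
  assumes "t \<ge> 1"
  shows "harm_weight s t n \<le> (\<Sum>j=1..s. coeff_A s t j) * (harm (Suc n) / real (Suc n))"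
  unfolding harm_weight_def sum_distrib_right
  by (intro sum_mono mult_left_mono coeff_A_nonneg zeta_partial_div_power_le_harm) (use assms in auto)

text \<open>Merges the exponents after the kernel has been expanded; \<open>c\<close> will be 1 or
  \<open>harm (Suc n)\<close>.\<close>

lemma harm_weight_div_power:
  "c * harm_weight s t n / real (Suc n) ^ i =
    (\<Sum>j=1..s. coeff_A s t j * (c * zeta_partial (Suc n) j / real (Suc n) ^ (s + t + i - j)))"
  unfolding harm_weight_def sum_distrib_left sum_divide_distrib
proof (rule sum.cong[OF refl])
  fix j assume "j \<in> {1..s}"
  then have "s + t + i - j = s + t - j + i" by auto
  then show "c * (coeff_A s t j * (zeta_partial (Suc n) j / real (Suc n) ^ (s + t - j))) / real (Suc n) ^ i =
      coeff_A s t j * (c * zeta_partial (Suc n) j / real (Suc n) ^ (s + t + i - j))"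
    by (simp add: power_add)
qed

lemma summable_mult_shifted_zeta:
  assumes "\<And>n. 0 \<le> a n" "\<And>n. a n \<le> C * (harm (Suc n) / real (Suc n))" "p \<ge> 1"
  shows "summable (\<lambda>n. a n * shifted_zeta p (Suc n))"
  using assms(3)
  by (intro summable_mult_harm_bounded[OF assms(1,2)] shifted_zeta_nonneg shifted_zeta_le) simp_all

lemma summable_div_power:
  assumes "\<And>n. 0 \<le> a n" "\<And>n. a n \<le> C * (harm (Suc n) / real (Suc n))" "i \<ge> 1"
  shows "summable (\<lambda>n. a n / real (Suc n) ^ i)"
  using summable_mult_harm_bounded[OF assms(1,2), of "\<lambda>n. 1 / real (Suc n) ^ i"]
    inverse_power_le_harm[OF assms(3)] by simp

lemma summable_harm_mult_div_power:
  assumes "\<And>n. 0 \<le> a n" "\<And>n. a n \<le> C * (harm (Suc n) / real (Suc n))" "i \<ge> 1"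
  shows "summable (\<lambda>n. harm (Suc n) * a n / real (Suc n) ^ i)"
  using summable_mult_harm_bounded[OF assms(1,2), of "\<lambda>n. harm (Suc n) / real (Suc n) ^ i"]
    harm_div_power_le[OF assms(3)] by (simp add: harm_nonneg mult_ac)

text \<open>The closed form of the kernel may be inserted and the series split, since each of the
  \<open>p\<close> resulting series converges on its own.\<close>

lemma suminf_mult_shifted_zeta:
  assumes "\<And>n. 0 \<le> a n" "\<And>n. a n \<le> C * (harm (Suc n) / real (Suc n))" "p \<ge> 1"
  shows "(\<Sum>n. a n * shifted_zeta p (Suc n)) =
    (\<Sum>i=1..p-1. (-1) ^ (i-1) * zeta_nat (p + 1 - i) * (\<Sum>n. a n / real (Suc n) ^ i)) +
    (-1) ^ (p-1) * (\<Sum>n. harm (Suc n) * a n / real (Suc n) ^ p)"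
proof -
  have "(\<lambda>n. (\<Sum>i=1..p-1. (-1) ^ (i-1) * zeta_nat (p + 1 - i) * (a n / real (Suc n) ^ i)) +
      (-1) ^ (p-1) * (harm (Suc n) * a n / real (Suc n) ^ p)) sums
    ((\<Sum>i=1..p-1. (-1) ^ (i-1) * zeta_nat (p + 1 - i) * (\<Sum>n. a n / real (Suc n) ^ i)) +
      (-1) ^ (p-1) * (\<Sum>n. harm (Suc n) * a n / real (Suc n) ^ p))"
    by (intro sums_add sums_sum sums_mult summable_sums summable_div_power[OF assms(1,2)]
        summable_harm_mult_div_power[OF assms]) auto
  also have "(\<lambda>n. (\<Sum>i=1..p-1. (-1) ^ (i-1) * zeta_nat (p + 1 - i) * (a n / real (Suc n) ^ i)) +
      (-1) ^ (p-1) * (harm (Suc n) * a n / real (Suc n) ^ p)) = (\<lambda>n. a n * shifted_zeta p (Suc n))"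
    by (subst shifted_zeta_eq) (use assms(3) in
        \<open>auto simp: distrib_left sum_distrib_left mult_ac simp del: of_nat_Suc\<close>)
  finally show ?thesis by (rule sums_unique[symmetric])
qed

section \<open>Integrals of products of polylogarithms\<close>

text \<open>Each term of the series for \<open>f\<close> contains a factor x, which cancels the
  denominator and leaves the nonnegative functions a_n x^n Li_p(x), whose integrals are a_n times
  the kernel.\<close>

lemma power_series_mult_polylog_has_integral:
  assumes "\<And>n. 0 \<le> a n" "\<And>n. a n \<le> C * (harm (Suc n) / real (Suc n))" "p \<ge> 1"
    and f: "\<And>x. 0 \<le> x \<Longrightarrow> x < 1 \<Longrightarrow> (\<lambda>n. a n * x ^ Suc n) sums f x"
  shows "((\<lambda>x. f x * polylog p x / x) has_integral (\<Sum>n. a n * shifted_zeta p (Suc n))) {0..1}"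
  unfolding has_integral_Icc_iff_Ico
proof (rule has_integral_suminf_nonneg)
  show "((\<lambda>x. a n * (x ^ n * polylog p x)) has_integral a n * shifted_zeta p (Suc n)) {0..<1}" for n
    using power_mult_polylog_has_integral[OF assms(3), of n]
    unfolding has_integral_Icc_iff_Ico by (rule has_integral_mult_right)
next
  fix n and x :: real assume x: "x \<in> {0..<1}"
  have "0 \<le> polylog p x"
    using x by (intro sums_le[OF _ sums_zero polylog_sums[of x p]]) auto
  then show "0 \<le> a n * (x ^ n * polylog p x)"
    using assms(1) x by simp
next
  fix x :: real assume x: "x \<in> {0..<1}"
  show "(\<lambda>n. a n * (x ^ n * polylog p x)) sums (f x * polylog p x / x)"
  \<comment> \<open>At 0 both sides vanish, because \<open>polylog p 0 = 0\<close> and division by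
    zero yields 0.\<close>
  proof (cases "x = 0")
    case False
    have "(\<lambda>n. a n * x ^ Suc n * (polylog p x / x)) sums (f x * (polylog p x / x))"
      using x by (intro sums_mult2 f) auto
    then show ?thesis using False by (simp add: mult_ac)
  qed simp
next
  show "summable (\<lambda>n. a n * shifted_zeta p (Suc n))"
    using assms(1-3) by (rule summable_mult_shifted_zeta)
qed

lemma polylog_I1_has_integral:
  assumes "q \<ge> 1" "p \<ge> 1"
  shows "((\<lambda>x. polylog q x * polylog p x / x) has_integral
    (\<Sum>n. 1 / real (Suc n) ^ q * shifted_zeta p (Suc n))) {0..1}"
proof (rule power_series_mult_polylog_has_integral[where C = 1])
  show "(\<lambda>n. 1 / real (Suc n) ^ q * x ^ Suc n) sums polylog q x" if "0 \<le> x" "x < 1" for x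
    using polylog_sums[of x q] that by simp
qed (use assms inverse_power_le_harm[of q] in auto)

lemma polylog_I1_commute: "polylog_I1 a b = polylog_I1 b a"
  by (simp add: polylog_I1_def mult.commute)

text \<open>The coefficients of Li_s Li_t are integrated against Li_p(x)/x first; only the resulting
  series is split, and its subtracted part is a multiple of
  \<open>polylog_I1 (s + t) p\<close>.\<close>

lemma polylog_prod3_has_integral:
  assumes "s \<ge> 1" "t \<ge> 1" "p \<ge> 1"
  shows "((\<lambda>x. polylog s x * polylog t x * polylog p x / x) has_integral
    (\<Sum>n. (harm_weight s t n + harm_weight t s n) * shifted_zeta p (Suc n)) -
    ((\<Sum>j=1..s. coeff_A s t j) + (\<Sum>j=1..t. coeff_A t s j)) * polylog_I1 (s + t) p) {0..1}"
proof -
  \<comment> \<open>This constant has two roles: it is the factor of 1/(n+1)^(s+t) in the product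
    coefficients and the constant in the bound for \<open>W\<close>.\<close>
  define C where "C = (\<Sum>j=1..s. coeff_A s t j) + (\<Sum>j=1..t. coeff_A t s j)"
  define W where "W n = harm_weight s t n + harm_weight t s n" for n
  have W_nonneg: "0 \<le> W n" for n
    unfolding W_def by (intro add_nonneg_nonneg harm_weight_nonneg)
  have W_le: "W n \<le> C * (harm (Suc n) / real (Suc n))" for n
    unfolding W_def C_def distrib_right by (intro add_mono harm_weight_le assms)
  have coeff_eq: "polylog_prod_coeff s t n = W n - C * (1 / real (Suc n) ^ (s + t))" for n
    using polylog_prod_coeff_eq[OF assms(1), of t n] by (simp add: W_def C_def)
  have "0 \<le> C"
    unfolding C_def by (intro add_nonneg_nonneg sum_nonneg coeff_A_nonneg)
  then have "0 \<le> C * (1 / real (Suc n) ^ (s + t))" for n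
    by simp
  then have "polylog_prod_coeff s t n \<le> C * (harm (Suc n) / real (Suc n))" for n
    using W_le[of n] unfolding coeff_eq by (smt (verit))
  then have "((\<lambda>x. polylog s x * polylog t x * polylog p x / x) has_integral
      (\<Sum>n. polylog_prod_coeff s t n * shifted_zeta p (Suc n))) {0..1}"
    by (intro power_series_mult_polylog_has_integral[where C = C] polylog_prod_coeff_nonneg
        polylog_prod_sums assms) auto
  also have "(\<Sum>n. polylog_prod_coeff s t n * shifted_zeta p (Suc n)) =
      (\<Sum>n. W n * shifted_zeta p (Suc n)) -
      C * (\<Sum>n. 1 / real (Suc n) ^ (s + t) * shifted_zeta p (Suc n))"
  proof (rule sums_unique[symmetric])
    have "summable (\<lambda>n. 1 / real (Suc n) ^ (s + t) * shifted_zeta p (Suc n))"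
      using assms inverse_power_le_harm[of "s + t"]
      by (intro summable_mult_shifted_zeta[where C = 1]) auto
    then have "(\<lambda>n. W n * shifted_zeta p (Suc n) - C * (1 / real (Suc n) ^ (s + t) * shifted_zeta p (Suc n)))
      sums ((\<Sum>n. W n * shifted_zeta p (Suc n)) -
        C * (\<Sum>n. 1 / real (Suc n) ^ (s + t) * shifted_zeta p (Suc n)))"
      by (intro sums_diff sums_mult summable_sums summable_mult_shifted_zeta[OF W_nonneg W_le assms(3)])
    then show "(\<lambda>n. polylog_prod_coeff s t n * shifted_zeta p (Suc n)) sums
      ((\<Sum>n. W n * shifted_zeta p (Suc n)) -
        C * (\<Sum>n. 1 / real (Suc n) ^ (s + t) * shifted_zeta p (Suc n)))"
      by (simp only: coeff_eq left_diff_distrib mult.assoc)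
  qed
  also have "(\<Sum>n. 1 / real (Suc n) ^ (s + t) * shifted_zeta p (Suc n)) = polylog_I1 (s + t) p"
    unfolding polylog_I1_def
    using polylog_I1_has_integral[of "s + t" p] assms by (simp add: integral_unique)
  finally show ?thesis by (simp only: W_def C_def)
qed

section \<open>The two groupings of the triple product\<close>

theorem theorem2p4:
  fixes s t :: nat
  assumes "s \<ge> 1" and "t \<ge> 1"
  shows
    "(\<lambda>x. (polylog s x)\<^sup>2 * polylog t x / x) integrable_on {0..1}
   \<and> (\<lambda>x. polylog (2 * s) x * polylog t x / x) integrable_on {0..1}
   \<and> (\<lambda>x. polylog s x * polylog (s+t) x / x) integrable_on {0..1}
   \<and> (\<forall>j\<in>{1..s}. \<forall>i\<in>{1..t-1}.
        summable (\<lambda>n. zeta_partial (Suc n) j / real (Suc n) ^ (2 * s+i-j)))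
   \<and> (\<forall>j\<in>{1..s}.
        summable (\<lambda>n. harm (Suc n) * zeta_partial (Suc n) j / real (Suc n) ^ (2 * s+t-j)))
   \<and> summable (\<lambda>n.
        (\<Sum>j=1..s. coeff_A s t j * (harm (Suc n) * zeta_partial (Suc n) j / real (Suc n) ^ (2 * s+t-j)))
      + (\<Sum>j=1..t. coeff_B s t j * (harm (Suc n) * zeta_partial (Suc n) j / real (Suc n) ^ (2 * s+t-j))))
   \<and> (\<forall>i\<in>{1..s-1}. summable (\<lambda>n.
        (\<Sum>j=1..s. coeff_A s t j * (zeta_partial (Suc n) j / real (Suc n) ^ (s+t+i-j)))
      + (\<Sum>j=1..t. coeff_B s t j * (zeta_partial (Suc n) j / real (Suc n) ^ (s+t+i-j)))))
   \<and> integral {0..1} (\<lambda>x. (polylog s x)\<^sup>2 * polylog t x / x)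
      = 2 * (\<Sum>j=1..s. coeff_A s s j *
              ((\<Sum>i=1..t-1. (-1) ^ (i-1) * zeta_nat (t+1-i) *
                  (\<Sum>n. zeta_partial (Suc n) j / real (Suc n) ^ (2 * s+i-j)))
               + (-1) ^ (t-1) *
                  (\<Sum>n. harm (Suc n) * zeta_partial (Suc n) j / real (Suc n) ^ (2 * s+t-j))))
        - 2 * (\<Sum>j=1..s. coeff_A s s j * polylog_I1 (2 * s) t)
   \<and> integral {0..1} (\<lambda>x. (polylog s x)\<^sup>2 * polylog t x / x)
      = (-1) ^ (s-1) *
          (\<Sum>n.
             (\<Sum>j=1..s. coeff_A s t j * (harm (Suc n) * zeta_partial (Suc n) j / real (Suc n) ^ (2 * s+t-j)))
           + (\<Sum>j=1..t. coeff_B s t j * (harm (Suc n) * zeta_partial (Suc n) j / real (Suc n) ^ (2 * s+t-j))))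
        + (\<Sum>i=1..s-1. (-1) ^ (i-1) * zeta_nat (s+1-i) *
             (\<Sum>n.
                (\<Sum>j=1..s. coeff_A s t j * (zeta_partial (Suc n) j / real (Suc n) ^ (s+t+i-j)))
              + (\<Sum>j=1..t. coeff_B s t j * (zeta_partial (Suc n) j / real (Suc n) ^ (s+t+i-j)))))
        - ((\<Sum>j=1..s. coeff_A s t j) + (\<Sum>j=1..t. coeff_B s t j)) * polylog_I1 s (s+t)"
proof -
  define W where "W n = harm_weight s t n + harm_weight t s n" for n
  define J where "J = integral {0..1} (\<lambda>x. (polylog s x)\<^sup>2 * polylog t x / x)"
  \<comment> \<open>The first formula keeps the sum over j outside the series, so each j is bounded
    separately; here 2s - j \<ge> s \<ge> 1.\<close>
  have zeta_bounds: "0 \<le> zeta_partial (Suc n) j / real (Suc n) ^ (2 * s - j)"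
      "zeta_partial (Suc n) j / real (Suc n) ^ (2 * s - j) \<le> 1 * (harm (Suc n) / real (Suc n))"
    if "j \<in> {1..s}" for j n
  proof -
    have "1 \<le> j" "1 \<le> 2 * s - j" using that assms(1) by auto
    then show "zeta_partial (Suc n) j / real (Suc n) ^ (2 * s - j) \<le> 1 * (harm (Suc n) / real (Suc n))"
      using zeta_partial_div_power_le_harm[of j "2 * s - j" n] by simp
  qed (simp add: zeta_partial_nonneg)
  have zeta_div: "c * (zeta_partial (Suc n) j / real (Suc n) ^ (2 * s - j)) / real (Suc n) ^ i =
      c * zeta_partial (Suc n) j / real (Suc n) ^ (2 * s + i - j)" if "j \<in> {1..s}" for c i j n
  proof -
    have "2 * s + i - j = 2 * s - j + i" using that by auto
    then show ?thesis by (simp add: power_add)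
  qed
  have W_bounds: "0 \<le> W n"
    "W n \<le> ((\<Sum>j=1..s. coeff_A s t j) + (\<Sum>j=1..t. coeff_A t s j)) * (harm (Suc n) / real (Suc n))" for n
    unfolding W_def distrib_right
    by (intro add_nonneg_nonneg harm_weight_nonneg add_mono harm_weight_le assms)+
  \<comment> \<open>The second formula keeps the sums over j inside the series, so \<open>W\<close>
    is treated as one sequence and expanded only at the end.\<close>
  have W_div: "c * W n / real (Suc n) ^ i =
      (\<Sum>j=1..s. coeff_A s t j * (c * zeta_partial (Suc n) j / real (Suc n) ^ (s + t + i - j))) +
      (\<Sum>j=1..t. coeff_B s t j * (c * zeta_partial (Suc n) j / real (Suc n) ^ (s + t + i - j)))" for c i n
    unfolding W_def distrib_left add_divide_distrib harm_weight_div_power coeff_B_eq_coeff_A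
    by (simp only: add.commute[of t s])
  have exps: "s + t + s - j = 2 * s + t - j" for j by simp

  \<comment> \<open>Grouping (Li_s Li_s) Li_t: the two halves of the decomposition coincide, whence
    the factor 2.\<close>
  have int1: "((\<lambda>x. (polylog s x)\<^sup>2 * polylog t x / x) has_integral
      (\<Sum>n. (harm_weight s s n + harm_weight s s n) * shifted_zeta t (Suc n)) -
      ((\<Sum>j=1..s. coeff_A s s j) + (\<Sum>j=1..s. coeff_A s s j)) * polylog_I1 (2 * s) t) {0..1}"
    using polylog_prod3_has_integral[OF assms(1) assms(1) assms(2)]
    by (simp only: power2_eq_square mult_2)
  \<comment> \<open>Grouping (Li_s Li_t) Li_s of the same integrand.\<close>
  have "((\<lambda>x. polylog s x * polylog t x * polylog s x / x) has_integral
      (\<Sum>n. W n * shifted_zeta s (Suc n)) -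
      ((\<Sum>j=1..s. coeff_A s t j) + (\<Sum>j=1..t. coeff_A t s j)) * polylog_I1 (s + t) s) {0..1}"
    unfolding W_def by (rule polylog_prod3_has_integral[OF assms assms(1)])
  then have int2: "((\<lambda>x. (polylog s x)\<^sup>2 * polylog t x / x) has_integral
      (\<Sum>n. W n * shifted_zeta s (Suc n)) -
      ((\<Sum>j=1..s. coeff_A s t j) + (\<Sum>j=1..t. coeff_B s t j)) * polylog_I1 s (s + t)) {0..1}"
    by (simp add: power2_eq_square mult_ac coeff_B_eq_coeff_A polylog_I1_commute[of s])

  \<comment> \<open>The finite sum over j is exchanged with the series over n, so that the kernel
    can be expanded for each j.\<close>
  have "(\<lambda>n. \<Sum>j=1..s. coeff_A s s j *
      (zeta_partial (Suc n) j / real (Suc n) ^ (2 * s - j) * shifted_zeta t (Suc n))) sums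
    (\<Sum>j=1..s. coeff_A s s j *
      (\<Sum>n. zeta_partial (Suc n) j / real (Suc n) ^ (2 * s - j) * shifted_zeta t (Suc n)))"
    by (intro sums_sum sums_mult summable_sums summable_mult_shifted_zeta[OF zeta_bounds assms(2)])
  from sums_mult[OF this, of 2]
  have "(\<lambda>n. (harm_weight s s n + harm_weight s s n) * shifted_zeta t (Suc n)) sums
    (2 * (\<Sum>j=1..s. coeff_A s s j *
      (\<Sum>n. zeta_partial (Suc n) j / real (Suc n) ^ (2 * s - j) * shifted_zeta t (Suc n))))"
    by (simp add: harm_weight_def sum_distrib_right mult_2[symmetric] mult.assoc del: of_nat_Suc)
  then have "(\<Sum>n. (harm_weight s s n + harm_weight s s n) * shifted_zeta t (Suc n)) =
    2 * (\<Sum>j=1..s. coeff_A s s j *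
      (\<Sum>n. zeta_partial (Suc n) j / real (Suc n) ^ (2 * s - j) * shifted_zeta t (Suc n)))"
    by (rule sums_unique[symmetric])
  also have "(\<Sum>j=1..s. coeff_A s s j *
      (\<Sum>n. zeta_partial (Suc n) j / real (Suc n) ^ (2 * s - j) * shifted_zeta t (Suc n))) =
    (\<Sum>j=1..s. coeff_A s s j *
      ((\<Sum>i=1..t-1. (-1) ^ (i-1) * zeta_nat (t+1-i) *
          (\<Sum>n. zeta_partial (Suc n) j / real (Suc n) ^ (2 * s+i-j)))
       + (-1) ^ (t-1) * (\<Sum>n. harm (Suc n) * zeta_partial (Suc n) j / real (Suc n) ^ (2 * s+t-j))))"
  proof (rule sum.cong[OF refl])
    fix j assume j: "j \<in> {1..s}"
    show "coeff_A s s j *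
        (\<Sum>n. zeta_partial (Suc n) j / real (Suc n) ^ (2 * s - j) * shifted_zeta t (Suc n)) =
      coeff_A s s j *
        ((\<Sum>i=1..t-1. (-1) ^ (i-1) * zeta_nat (t+1-i) *
          (\<Sum>n. zeta_partial (Suc n) j / real (Suc n) ^ (2 * s+i-j)))
       + (-1) ^ (t-1) * (\<Sum>n. harm (Suc n) * zeta_partial (Suc n) j / real (Suc n) ^ (2 * s+t-j)))"
      unfolding suminf_mult_shifted_zeta[OF zeta_bounds[OF j] assms(2)] zeta_div[OF j]
        zeta_div[OF j, of 1, unfolded mult_1] ..
  qed
  finally have formula1: "J = 2 * (\<Sum>j=1..s. coeff_A s s j *
      ((\<Sum>i=1..t-1. (-1) ^ (i-1) * zeta_nat (t+1-i) *
          (\<Sum>n. zeta_partial (Suc n) j / real (Suc n) ^ (2 * s+i-j)))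
       + (-1) ^ (t-1) * (\<Sum>n. harm (Suc n) * zeta_partial (Suc n) j / real (Suc n) ^ (2 * s+t-j))))
      - 2 * (\<Sum>j=1..s. coeff_A s s j * polylog_I1 (2 * s) t)"
    unfolding J_def integral_unique[OF int1]
    by (simp only: sum_distrib_right[symmetric] mult_2[symmetric] mult.assoc)

  have formula2: "J = (-1) ^ (s-1) * (\<Sum>n. harm (Suc n) * W n / real (Suc n) ^ s) +
      (\<Sum>i=1..s-1. (-1) ^ (i-1) * zeta_nat (s+1-i) * (\<Sum>n. W n / real (Suc n) ^ i)) -
      ((\<Sum>j=1..s. coeff_A s t j) + (\<Sum>j=1..t. coeff_B s t j)) * polylog_I1 s (s + t)"
    unfolding J_def integral_unique[OF int2] suminf_mult_shifted_zeta[OF W_bounds assms(1)] by simp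

  note W_div1 = W_div[of 1, unfolded mult_1]
  have integrable: "(\<lambda>x. polylog (2 * s) x * polylog t x / x) integrable_on {0..1}"
    "(\<lambda>x. polylog s x * polylog (s + t) x / x) integrable_on {0..1}"
    by (rule has_integral_integrable, rule polylog_I1_has_integral; use assms in simp)+
  have summable1: "summable (\<lambda>n. zeta_partial (Suc n) j / real (Suc n) ^ (2 * s+i-j))"
    if "j \<in> {1..s}" "i \<in> {1..t-1}" for i j
    using summable_div_power[OF zeta_bounds[OF that(1)], of i] that(2)
    unfolding zeta_div[OF that(1), of 1, unfolded mult_1] by simp
  have summable2: "summable (\<lambda>n. harm (Suc n) * zeta_partial (Suc n) j / real (Suc n) ^ (2 * s+t-j))"
    if "j \<in> {1..s}" for j
    using summable_harm_mult_div_power[OF zeta_bounds[OF that] assms(2)]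
    unfolding zeta_div[OF that] .
  have summable3: "summable (\<lambda>n. W n / real (Suc n) ^ i)" if "i \<in> {1..s-1}" for i
    by (rule summable_div_power[OF W_bounds]) (use that in simp)
  show ?thesis
    by (intro conjI ballI)
       (rule has_integral_integrable[OF int1], rule integrable, rule integrable,
        rule summable1, assumption, assumption, rule summable2, assumption,
        rule summable_harm_mult_div_power[OF W_bounds assms(1), unfolded W_div exps],
        rule summable3[unfolded W_div1], assumption,
        rule formula1[unfolded J_def], rule formula2[unfolded J_def W_div W_div1 exps])
qed

end
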